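(* Let $T\in TQ$, let $\overline T:\mathbb{T}^2\to\mathbb{T}^2$ be the induced torus diffeomorphism, and let $x\in\mathbb{T}^2$ belong to a periodic orbit or to a quasi-periodic set of $\overline T$. Then one of the following two situations holds: 1) there exists $C>0$ such that $|p_2\circ T^n(\tilde x)-p_2(\tilde x)|<C$ for all $n>0$ and all $\tilde x\in p^{-1}(x)$, and in this case $\rho(x,T)=(\omega,0)$ for some $\omega\in[0,1[$; 2) $p_2\circ T^n(\tilde x)\to+\infty$ as $n\to\infty$ for all $\tilde x\in p^{-1}(x)$, or $p_2\circ T^n(\tilde x)\to-\infty$ as $n\to\infty$ for all $\tilde x\in p^{-1}(x)$, and in this case $\rho(x,T)=(+\infty,\omega)$, respectively $\rho(x,T)=(-\infty,\omega)$, for some $\omega\in\mathbb{R}\setminus\{0\}$.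
   Context: Write $S^1=\mathbb{R}/\mathbb{Z}$, $\mathbb{T}^2=\mathbb{R}^2/\mathbb{Z}^2$, let $p:\mathbb{R}^2\to\mathbb{T}^2$ be the covering map, $p_1(\phi,I)=\phi$, $p_2(\phi,I)=I$ the projections, and $\overline{\mathbb{R}}=\mathbb{R}\cup\{-\infty,+\infty\}$. The set $TQ$: the set of all $C^1$ diffeomorphisms $T=(T_\phi,T_I):\mathbb{R}^2\to\mathbb{R}^2$, $(\phi,I)\mapsto(T_\phi(\phi,I),T_I(\phi,I))$, that are lifts of $C^1$ diffeomorphisms of the cylinder $S^1\times\mathbb{R}$ and satisfy: $\partial_I T_\phi(\phi,I)>0$ everywhere (twist to the right); $T_I(\phi,I)\to\pm\infty$ and $T_\phi(\phi,I)\to\pm\infty$ as $I\to\pm\infty$; and for all $(\phi,I)$: $T_I(\phi+1,I)=T_I(\phi,I)$, $T_I(\phi,I+1)=T_I(\phi,I)+1$, $T_\phi(\phi+1,I)=T_\phi(\phi,I)+1$, $T_\phi(\phi,I+1)=T_\phi(\phi,I)+1$. Each $T\in TQ$ induces a diffeomorphism $\widehat T$ of $S^1\times\mathbb{R}$ and a diffeomorphism $\overline T$ of $\mathbb{T}^2$. Rotation vector: for $\tilde x\in\mathbb{R}^2$ put $\rho(\tilde x,T)=\lim_{n\to\infty}\frac{T^n(\tilde x)-\tilde x}{n}\in\overline{\mathbb{R}}^2$ if the limit exists. For $x=p(\tilde x)\in\mathbb{T}^2$: if $\rho(\tilde x,T)$ exists and $p_1(\rho(\tilde x,T))\in\mathbb{R}$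 (in which case its second coordinate is $0$), define $\rho(x,T)=\left(p_1(\rho(\tilde x,T))\ (\mathrm{mod}\ 1),\,0\right)$, the first coordinate being represented in $[0,1[$; if $|p_1(\rho(\tilde x,T))|=\infty$, define $\rho(x,T)=\rho(\tilde x,T)$. These do not depend on the choice of $\tilde x\in p^{-1}(x)$. Periodic orbit: the orbit $\{x,\overline T(x),\dots,\overline T^{n-1}(x)\}$ of a point with $\overline T^n(x)=x$, $n\geq1$ minimal. Quasi-periodic set: a set $Q\subset\mathbb{T}^2$ is quasi-periodic for $\overline T$ if either (1) $Q$ is the projection to $\mathbb{T}^2$ of an Aubry–Mather set $\widehat Q\subset S^1\times\mathbb{R}$ of $\widehat T$ (a compact $\widehat T$-invariant set on which $p_1$ is injective and $\widehat T$ preserves the cyclic order of the first coordinates, with irrational rotation number), in which case $p_1\circ\rho(z,T)\in[0,1[$ is an irrational number not depending on $z\in Q$; or (2) $Q$ is a compact $\overline T$-invariant set such that $p_2\circ\rho(z,T)$ is an irrational number not depending on $z\in Q$. *)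

theory Defs
  imports "HOL-Analysis.Analysis"
begin

section \<open>Circle, cylinder and torus\<close>

lemma equivp_circle: "equivp (\<lambda>x y :: real. x - y \<in> \<int>)"
proof (rule equivpI)
  show "reflp (\<lambda>x y :: real. x - y \<in> \<int>)"
    by (simp add: reflp_def)
  show "symp (\<lambda>x y :: real. x - y \<in> \<int>)"
    by (rule sympI) (metis Ints_minus minus_diff_eq)
  show "transp (\<lambda>x y :: real. x - y \<in> \<int>)"
    by (rule transpI) (metis Ints_add diff_add_cancel add_diff_eq)
qed

quotient_type circle = real / "\<lambda>x y :: real. x - y \<in> \<int>"
  morphisms rep_circle to_circle
  by (rule equivp_circle)

instantiation circle :: topological_space
begin

text \<open>The quotient topology. The cylinder \<open>circle \<times> real\<close> and the torus
  \<open>circle \<times> circle\<close> then carry the product topologies.\<close>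

definition open_circle :: "circle set \<Rightarrow> bool" where
  "open_circle U \<longleftrightarrow> open (to_circle -` U)"

instance
  by standard
    (auto simp: open_circle_def vimage_Union)

end

type_synonym plane = "real \<times> real"
type_synonym cylinder = "circle \<times> real"
type_synonym torus = "circle \<times> circle"

definition cyl_proj :: "plane \<Rightarrow> cylinder" where
  "cyl_proj = map_prod to_circle id"

definition torus_proj :: "plane \<Rightarrow> torus" where
  "torus_proj = map_prod to_circle to_circle"

definition cyl_to_torus :: "cylinder \<Rightarrow> torus" where
  "cyl_to_torus = map_prod id to_circle"

text \<open>\<open>a\<close>, \<open>b\<close>, \<open>c\<close> are pairwise distinct and met in this order when the circle is
  traversed once in the positive direction.\<close>

definition cyclic_order :: "circle \<Rightarrow> circle \<Rightarrow> circle \<Rightarrow> bool" where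
  "cyclic_order a b c \<longleftrightarrow>
     (\<exists>r s t. to_circle r = a \<and> to_circle s = b \<and> to_circle t = c \<and>
              r < s \<and> s < t \<and> t < r + 1)"

section \<open>Diffeomorphisms of class $C^1$\<close>

definition C1_on :: "plane set \<Rightarrow> (plane \<Rightarrow> plane) \<Rightarrow> bool" where
  "C1_on U f \<longleftrightarrow>
     (\<exists>f' :: plane \<Rightarrow> plane \<Rightarrow>\<^sub>L plane.
        (\<forall>z\<in>U. (f has_derivative blinfun_apply (f' z)) (at z)) \<and> continuous_on U f')"

definition C1_diffeo_plane :: "(plane \<Rightarrow> plane) \<Rightarrow> bool" where
  "C1_diffeo_plane f \<longleftrightarrow> bij f \<and> C1_on UNIV f \<and> C1_on UNIV (inv f)"

text \<open>The charts of the cylinder are the local inverses of the covering map \<open>cyl_proj\<close>;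
  a map is of class $C^1$ iff it is locally covered by $C^1$ maps of the plane.\<close>

definition C1_cylinder :: "(cylinder \<Rightarrow> cylinder) \<Rightarrow> bool" where
  "C1_cylinder F \<longleftrightarrow>
     (\<forall>z. \<exists>U G. open U \<and> z \<in> U \<and> C1_on U G \<and>
            (\<forall>w\<in>U. cyl_proj (G w) = F (cyl_proj w)))"

definition C1_diffeo_cylinder :: "(cylinder \<Rightarrow> cylinder) \<Rightarrow> bool" where
  "C1_diffeo_cylinder F \<longleftrightarrow> bij F \<and> C1_cylinder F \<and> C1_cylinder (inv F)"

section \<open>The set \<open>TQ\<close> and the induced maps\<close>

definition TQ :: "(plane \<Rightarrow> plane) set" where
  "TQ = {T. C1_diffeo_plane T \<and>
     (\<exists>F. C1_diffeo_cylinder F \<and> (\<forall>z. cyl_proj (T z) = F (cyl_proj z))) \<and>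
     (\<forall>\<phi> I. deriv (\<lambda>s. fst (T (\<phi>, s))) I > 0) \<and>
     (\<forall>\<phi>. filterlim (\<lambda>I. snd (T (\<phi>, I))) at_top at_top) \<and>
     (\<forall>\<phi>. filterlim (\<lambda>I. snd (T (\<phi>, I))) at_bot at_bot) \<and>
     (\<forall>\<phi>. filterlim (\<lambda>I. fst (T (\<phi>, I))) at_top at_top) \<and>
     (\<forall>\<phi>. filterlim (\<lambda>I. fst (T (\<phi>, I))) at_bot at_bot) \<and>
     (\<forall>\<phi> I. snd (T (\<phi> + 1, I)) = snd (T (\<phi>, I))) \<and>
     (\<forall>\<phi> I. snd (T (\<phi>, I + 1)) = snd (T (\<phi>, I)) + 1) \<and>
     (\<forall>\<phi> I. fst (T (\<phi> + 1, I)) = fst (T (\<phi>, I)) + 1) \<and>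
     (\<forall>\<phi> I. fst (T (\<phi>, I + 1)) = fst (T (\<phi>, I)) + 1)}"

text \<open>Here \<open>inv cyl_proj\<close> and \<open>inv torus_proj\<close> choose an arbitrary lift of a point; the
  lemmas \<open>cyl_map_proj\<close> and \<open>torus_map_proj\<close> below show that for \<open>T \<in> TQ\<close> the choice is
  immaterial.\<close>

definition cyl_map :: "(plane \<Rightarrow> plane) \<Rightarrow> cylinder \<Rightarrow> cylinder" where
  "cyl_map T = cyl_proj \<circ> T \<circ> inv cyl_proj"

definition torus_map :: "(plane \<Rightarrow> plane) \<Rightarrow> torus \<Rightarrow> torus" where
  "torus_map T = torus_proj \<circ> T \<circ> inv torus_proj"

section \<open>Rotation vectors\<close>

definition has_rotation_vector ::
    "(plane \<Rightarrow> plane) \<Rightarrow> plane \<Rightarrow> ereal \<times> ereal \<Rightarrow> bool" where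
  "has_rotation_vector T z v \<longleftrightarrow>
     (\<lambda>n. (ereal ((fst ((T ^^ n) z) - fst z) / real n),
           ereal ((snd ((T ^^ n) z) - snd z) / real n))) \<longlonglongrightarrow> v"

text \<open>By \<open>has_rotation_vector_shift\<close> below, any lift of \<open>x\<close> leads to the same vector.\<close>

definition torus_has_rotation_vector ::
    "(plane \<Rightarrow> plane) \<Rightarrow> torus \<Rightarrow> ereal \<times> ereal \<Rightarrow> bool" where
  "torus_has_rotation_vector T x v \<longleftrightarrow>
     (\<exists>z w. torus_proj z = x \<and> has_rotation_vector T z w \<and>
        ((\<exists>r::real. fst w = ereal r \<and> v = (ereal (frac r), 0)) \<or>
         (\<bar>fst w\<bar> = \<infinity> \<and> v = w)))"

section \<open>Periodic orbits and quasi-periodic sets\<close>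

definition periodic_orbit :: "('a \<Rightarrow> 'a) \<Rightarrow> 'a set \<Rightarrow> bool" where
  "periodic_orbit f A \<longleftrightarrow>
     (\<exists>x n. n \<ge> 1 \<and> (f ^^ n) x = x \<and> (\<forall>m. 1 \<le> m \<and> m < n \<longrightarrow> (f ^^ m) x \<noteq> x) \<and>
            A = {(f ^^ k) x | k. k < n})"

text \<open>\<open>\<alpha>\<close> is the rotation number of every orbit of \<open>Q\<close>, measured with the lift \<open>T\<close>.\<close>

definition has_rotation_number :: "(plane \<Rightarrow> plane) \<Rightarrow> cylinder set \<Rightarrow> real \<Rightarrow> bool" where
  "has_rotation_number T Q \<alpha> \<longleftrightarrow>
     (\<forall>z. cyl_proj z \<in> Q \<longrightarrow>
        (\<lambda>n. (fst ((T ^^ n) z) - fst z) / real n) \<longlonglongrightarrow> \<alpha>)"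

definition Aubry_Mather_set :: "(plane \<Rightarrow> plane) \<Rightarrow> cylinder set \<Rightarrow> bool" where
  "Aubry_Mather_set T Q \<longleftrightarrow>
     compact Q \<and> cyl_map T ` Q = Q \<and> inj_on fst Q \<and>
     (\<forall>u\<in>Q. \<forall>v\<in>Q. \<forall>w\<in>Q. cyclic_order (fst u) (fst v) (fst w) \<longrightarrow>
        cyclic_order (fst (cyl_map T u)) (fst (cyl_map T v)) (fst (cyl_map T w))) \<and>
     (\<exists>\<alpha>. \<alpha> \<notin> \<rat> \<and> has_rotation_number T Q \<alpha>)"

definition quasi_periodic_set :: "(plane \<Rightarrow> plane) \<Rightarrow> torus set \<Rightarrow> bool" where
  "quasi_periodic_set T Q \<longleftrightarrow>
     (\<exists>Q'. Aubry_Mather_set T Q' \<and> Q = cyl_to_torus ` Q') \<or>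
     (compact Q \<and> torus_map T ` Q = Q \<and>
      (\<exists>\<omega>::real. \<omega> \<notin> \<rat> \<and>
         (\<forall>z\<in>Q. \<exists>v. torus_has_rotation_vector T z v \<and> snd v = ereal \<omega>)))"

section \<open>Independence of the choice of lifts\<close>

lemma to_circle_eq_iff: "to_circle x = to_circle y \<longleftrightarrow> x - y \<in> \<int>"
  by (rule circle.abs_eq_iff)

lemma diff_Ints_iff: "x - y \<in> \<int> \<longleftrightarrow> (\<exists>a::int. y = x + of_int a)" for x y :: real
proof
  assume "x - y \<in> \<int>"
  then obtain k where "x - y = of_int k" by (rule Ints_cases)
  then have "y = x + of_int (- k)" by simp
  then show "\<exists>a::int. y = x + of_int a" ..
qed auto

lemma surj_to_circle: "surj to_circle"
  by (metis Quotient3_abs_rep Quotient3_circle surjI)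

lemma cyl_proj_eq_iff:
  "cyl_proj z = cyl_proj w \<longleftrightarrow> (\<exists>a::int. w = (fst z + of_int a, snd z))"
proof -
  show ?thesis
    by (cases z; cases w) (auto simp: cyl_proj_def to_circle_eq_iff diff_Ints_iff)
qed

lemma torus_proj_eq_iff:
  "torus_proj z = torus_proj w \<longleftrightarrow> (\<exists>a b::int. w = (fst z + of_int a, snd z + of_int b))"
proof -
  show ?thesis
    by (cases z; cases w) (auto simp: torus_proj_def to_circle_eq_iff diff_Ints_iff)
qed

lemma surj_cyl_proj: "surj cyl_proj"
  unfolding cyl_proj_def by (intro map_prod_surj surj_to_circle surj_id)

lemma surj_torus_proj: "surj torus_proj"
  unfolding torus_proj_def by (intro map_prod_surj surj_to_circle)

lemma int_shift:
  fixes g h :: "real \<Rightarrow> real"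
  assumes "\<And>x. g (x + 1) = g x + c"
  shows "g (x + of_int a) = g x + of_int a * c"
proof (induction a rule: int_induct[where k = 0])
  case (step1 i)
  then show ?case using assms[of "x + of_int i"] by (simp add: algebra_simps)
next
  case (step2 i)
  then show ?case using assms[of "x + of_int i - 1"] by (simp add: algebra_simps)
qed simp

lemma TQ_shift:
  assumes "T \<in> TQ"
  shows "T (fst z + of_int a, snd z + of_int b) =
         (fst (T z) + of_int a + of_int b, snd (T z) + of_int b)"
proof -
  note d = assms[unfolded TQ_def mem_Collect_eq]
  have "fst (T (x + of_int a, y)) = fst (T (x, y)) + of_int a * 1" for x y
    by (rule int_shift) (use d in blast)
  moreover have "snd (T (x + of_int a, y)) = snd (T (x, y)) + of_int a * 0" for x y
    by (rule int_shift) (use d in simp)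
  moreover have "fst (T (x, y + of_int b)) = fst (T (x, y)) + of_int b * 1" for x y
    by (rule int_shift) (use d in blast)
  moreover have "snd (T (x, y + of_int b)) = snd (T (x, y)) + of_int b * 1" for x y
    by (rule int_shift) (use d in blast)
  ultimately show ?thesis by (simp add: prod_eq_iff)
qed

lemma TQ_funpow_shift:
  assumes "T \<in> TQ"
  shows "(T ^^ n) (fst z + of_int a, snd z + of_int b) =
         (fst ((T ^^ n) z) + of_int a + real n * of_int b, snd ((T ^^ n) z) + of_int b)"
proof (induction n)
  case (Suc n)
  then show ?case
    using TQ_shift[OF assms, of "(T ^^ n) z" "a + int n * b" b]
    by (simp add: algebra_simps)
qed simp

lemma cyl_map_proj:
  assumes "T \<in> TQ"
  shows "cyl_map T (cyl_proj z) = cyl_proj (T z)"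
proof -
  have "cyl_proj (inv cyl_proj (cyl_proj z)) = cyl_proj z"
    by (simp add: surj_cyl_proj surj_f_inv_f)
  then obtain a :: int where "z = (fst (inv cyl_proj (cyl_proj z)) + of_int a,
      snd (inv cyl_proj (cyl_proj z)))"
    using cyl_proj_eq_iff by metis
  then have "T z = (fst (T (inv cyl_proj (cyl_proj z))) + of_int a,
      snd (T (inv cyl_proj (cyl_proj z))))"
    using TQ_shift[OF assms, of "inv cyl_proj (cyl_proj z)" a 0] by simp
  then show ?thesis
    unfolding cyl_map_def comp_def by (subst cyl_proj_eq_iff) blast
qed

lemma torus_map_proj:
  assumes "T \<in> TQ"
  shows "torus_map T (torus_proj z) = torus_proj (T z)"
proof -
  have "torus_proj (inv torus_proj (torus_proj z)) = torus_proj z"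
    by (simp add: surj_torus_proj surj_f_inv_f)
  then obtain a b :: int where "z = (fst (inv torus_proj (torus_proj z)) + of_int a,
      snd (inv torus_proj (torus_proj z)) + of_int b)"
    using torus_proj_eq_iff by metis
  then have "T z = (fst (T (inv torus_proj (torus_proj z))) + of_int (a + b),
      snd (T (inv torus_proj (torus_proj z))) + of_int b)"
    using TQ_shift[OF assms, of "inv torus_proj (torus_proj z)" a b] by (simp add: add.assoc)
  then show ?thesis
    unfolding torus_map_def comp_def by (subst torus_proj_eq_iff) blast
qed

lemma has_rotation_vector_shift:
  assumes T: "T \<in> TQ" and v: "has_rotation_vector T z v"
  shows "has_rotation_vector T (fst z + of_int a, snd z + of_int b)
           (fst v + ereal (of_int b), snd v)"
proof -
  have 1: "(\<lambda>n. ereal ((fst ((T ^^ n) z) - fst z) / real n)) \<longlonglongrightarrow> fst v"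
    using tendsto_fst[OF v[unfolded has_rotation_vector_def]] by simp
  have 2: "(\<lambda>n. ereal ((snd ((T ^^ n) z) - snd z) / real n)) \<longlonglongrightarrow> snd v"
    using tendsto_snd[OF v[unfolded has_rotation_vector_def]] by simp
  have "(\<lambda>n. ereal ((fst ((T ^^ n) z) - fst z) / real n) + ereal (of_int b))
          \<longlonglongrightarrow> fst v + ereal (of_int b)"
    using 1 by (intro tendsto_add_ereal_general1) auto
  moreover have "\<forall>\<^sub>F n in sequentially.
      ereal ((fst ((T ^^ n) z) - fst z) / real n) + ereal (of_int b) =
      ereal ((fst ((T ^^ n) z) + of_int a + real n * of_int b - (fst z + of_int a)) / real n)"
    using eventually_gt_at_top[of 0] by eventually_elim (simp add: field_simps)
  ultimately have "(\<lambda>n. ereal ((fst ((T ^^ n) z) + of_int a + real n * of_int b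
      - (fst z + of_int a)) / real n)) \<longlonglongrightarrow> fst v + ereal (of_int b)"
    by (rule Lim_transform_eventually)
  with 2 show ?thesis
    unfolding has_rotation_vector_def
    by (intro tendsto_Pair) (simp_all add: TQ_funpow_shift[OF T])
qed

end

theory Submission
  imports Defs
begin

text \<open>Every lift \<open>z\<close> has an asymptotic vertical speed \<open>\<omega>\<close>: rational for periodic points, \<open>0\<close> on
  Aubry--Mather sets since these are bounded, irrational in the remaining case. The
  horizontal displacement of one step differs from the height by a \<open>\<int>\<^sup>2\<close>-periodic continuous, hence
  bounded, function. So if \<open>\<omega> > 0\<close>, the heights and hence the horizontal steps tend to \<open>+\<infinity>\<close>, and the
  horizontal speed, as a Cesaro mean of the steps, is \<open>+\<infinity>\<close>; similarly if \<open>\<omega> < 0\<close>.\<close>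

section \<open>Growth rates and averages of real sequences\<close>

text \<open>Once the increments exceed a given slope, the sequence lies above a line of that slope,
  and a line of slightly larger slope eventually beats any line of slope \<open>K\<close> through
  the origin.\<close>

lemma filterlim_at_top_div_of_increments:
  fixes u :: "nat \<Rightarrow> real"
  assumes "filterlim (\<lambda>n. u (Suc n) - u n) at_top sequentially"
  shows "filterlim (\<lambda>n. u n / real n) at_top sequentially"
  unfolding filterlim_at_top
proof
  fix K :: real
  \<comment> \<open>The slope \<open>K + 1\<close> leaves a surplus of \<open>n\<close> over
    \<open>K * n\<close>, which absorbs the constant inherited from the index
    \<open>N\<close>.\<close>
  obtain N where N: "\<And>n. n \<ge> N \<Longrightarrow> u (Suc n) - u n \<ge> K + 1"
    using assms unfolding filterlim_at_top eventually_sequentially by blast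
  have lower: "u n \<ge> u N + (K + 1) * (real n - real N)" if "n \<ge> N" for n
    using that
  proof (induction n rule: dec_induct)
    case (step n)
    then show ?case using N[of n] by (simp add: algebra_simps)
  qed simp
  \<comment> \<open>Beyond \<open>M\<close> the surplus \<open>n\<close> covers the constant deficit
    of the lower line.\<close>
  obtain M :: nat where M: "(K + 1) * real N - u N \<le> real M"
    using real_arch_simple by blast
  show "\<forall>\<^sub>F n in sequentially. K \<le> u n / real n"
    using eventually_ge_at_top[of "max (Suc N) M"]
  proof eventually_elim
    case (elim n)
    then have "real M \<le> real n" by simp
    with lower[of n] M elim have "K * real n \<le> u n" by (simp add: algebra_simps)
    with elim show ?case by (simp add: field_simps)
  qed
qed

lemma bounded_if_periodic:
  fixes d :: "nat \<Rightarrow> real"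
  assumes "n \<ge> 1" and per: "\<And>m. d (m + n) = d m"
  shows "\<exists>B>0. \<forall>m. \<bar>d m\<bar> < B"
proof -
  have mult: "d (m + k * n) = d m" for m k
  proof (induction k)
    case (Suc k)
    then show ?case using per[of "m + k * n"] by (simp add: ac_simps)
  qed simp
  \<comment> \<open>Reducing the index modulo \<open>n\<close> shows that only the first
    \<open>n\<close> values occur.\<close>
  have "d m \<in> d ` {..<n}" for m
    using mult[of "m mod n" "m div n"] assms(1) by (auto intro!: image_eqI[of _ _ "m mod n"])
  then have "finite (range d)"
    by (intro finite_subset[of "range d" "d ` {..<n}"]) auto
  then have "bounded (range d)" by (rule finite_imp_bounded)
  then obtain B where "B > 0" "\<And>m. \<bar>d m\<bar> \<le> B" by (auto simp: bounded_pos)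
  then show ?thesis by (intro exI[of _ "B + 1"]) (auto simp: add_pos_pos intro: le_less_trans[of _ B])
qed

lemma bounded_div_tendsto_0:
  fixes d :: "nat \<Rightarrow> real"
  assumes "\<And>m. \<bar>d m\<bar> \<le> B"
  shows "(\<lambda>m. d m / real m) \<longlonglongrightarrow> 0"
proof (rule Lim_null_comparison)
  show "(\<lambda>m. B / real m) \<longlonglongrightarrow> 0" by (rule lim_const_over_n)
  show "\<forall>\<^sub>F m in sequentially. norm (d m / real m) \<le> B / real m"
    by (simp add: divide_right_mono assms)
qed

text \<open>Removing the mean drift \<open>c / n\<close> per step leaves an
  \<open>n\<close>-periodic, hence bounded, sequence, which vanishes after division by
  \<open>m\<close>.\<close>

lemma div_tendsto_of_periodic_increments:
  fixes s :: "nat \<Rightarrow> real"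
  assumes "n \<ge> 1" and "\<And>m. s (m + n) = s m + c"
  shows "(\<lambda>m. (s m - s 0) / real m) \<longlonglongrightarrow> c / real n"
proof -
  define d where "d m = s m - s 0 - real m * (c / real n)" for m
  have "d (m + n) = d m" for m
    using assms by (simp add: d_def field_simps)
  then obtain B where "\<And>m. \<bar>d m\<bar> < B" using bounded_if_periodic[OF assms(1)] by blast
  then have "(\<lambda>m. d m / real m) \<longlonglongrightarrow> 0" by (intro bounded_div_tendsto_0 less_imp_le)
  then have "(\<lambda>m. d m / real m + c / real n) \<longlonglongrightarrow> 0 + c / real n"
    by (intro tendsto_intros)
  \<comment> \<open>The index 0 is excluded: there both quotients are 0 by convention and the
    identity fails unless \<open>c = 0\<close>.\<close>
  moreover have "\<forall>\<^sub>F m in sequentially. d m / real m + c / real n = (s m - s 0) / real m"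
    using eventually_gt_at_top[of 0] by eventually_elim (simp add: d_def field_simps)
  ultimately show ?thesis using Lim_transform_eventually by fastforce
qed

lemma filterlim_at_top_of_div_tendsto_pos:
  fixes s :: "nat \<Rightarrow> real"
  assumes lim: "(\<lambda>m. (s m - c) / real m) \<longlonglongrightarrow> \<omega>" and "\<omega> > 0"
  shows "filterlim s at_top sequentially"
proof -
  have "filterlim (\<lambda>m. (s m - c) / real m * real m) at_top sequentially"
    by (rule filterlim_tendsto_pos_mult_at_top[OF lim \<open>\<omega> > 0\<close> filterlim_real_sequentially])
  then have "filterlim (\<lambda>m. c + (s m - c) / real m * real m) at_top sequentially"
    by (intro filterlim_tendsto_add_at_top[OF tendsto_const])
  moreover have "\<forall>\<^sub>F m in sequentially. c + (s m - c) / real m * real m = s m"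
    using eventually_gt_at_top[of 0] by eventually_elim simp
  ultimately show ?thesis by (rule filterlim_mono_eventually[OF _ order.refl order.refl])
qed

section \<open>One-step displacement and comparison of lifts\<close>

lemma TQ_continuous_on:
  assumes "T \<in> TQ"
  shows "continuous_on S T"
proof -
  have "C1_on UNIV T" using assms by (simp add: TQ_def C1_diffeo_plane_def)
  then have "isCont T z" for z
    unfolding C1_on_def using has_derivative_continuous by blast
  then show ?thesis by (intro continuous_at_imp_continuous_on ballI)
qed

text \<open>An integer translation by \<open>(a, b)\<close> adds \<open>a + b\<close> both to
  \<open>fst (T z)\<close> and to \<open>fst z + snd z\<close>. The difference is therefore periodic
  in both variables and attains all its values on the compact unit square.\<close>

lemma TQ_horizontal_step:
  assumes T: "T \<in> TQ"
  shows "\<exists>C. \<forall>z. \<bar>fst (T z) - fst z - snd z\<bar> \<le> C"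
proof -
  define h where "h z = fst (T z) - fst z - snd z" for z
  have "compact (h ` cbox (0, 0) (1, 1))"
    unfolding h_def
    by (intro compact_continuous_image continuous_intros TQ_continuous_on[OF T] compact_cbox)
  then have "bounded (h ` cbox (0, 0) (1, 1))" by (rule compact_imp_bounded)
  then obtain C where C: "\<And>z. z \<in> cbox (0, 0) (1, 1) \<Longrightarrow> \<bar>h z\<bar> \<le> C"
    unfolding bounded_iff by auto
  have "\<bar>h z\<bar> \<le> C" for z
  proof -
    define w where "w = (frac (fst z), frac (snd z))"
    have "z = (fst w + of_int \<lfloor>fst z\<rfloor>, snd w + of_int \<lfloor>snd z\<rfloor>)"
      by (simp add: w_def frac_def)
    then have "h z = h w"
      using TQ_shift[OF T, of w "\<lfloor>fst z\<rfloor>" "\<lfloor>snd z\<rfloor>"] by (simp add: h_def w_def frac_def)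
    moreover have "w \<in> cbox (0, 0) (1, 1)"
      by (simp add: w_def cbox_Pair_eq frac_lt_1 less_imp_le)
    ultimately show ?thesis using C by simp
  qed
  then show ?thesis unfolding h_def by blast
qed

text \<open>The integer \<open>b\<close> is the same for all \<open>n\<close>, because the iterates
  commute with vertical unit translations in the second coordinate. Height statements for one lift
  thus carry over to all lifts.\<close>

lemma torus_proj_funpow_snd_diff:
  assumes "T \<in> TQ" and "torus_proj z = torus_proj w"
  obtains b :: int where "\<And>n. snd ((T ^^ n) w) = snd ((T ^^ n) z) + of_int b"
proof -
  obtain a b :: int where "w = (fst z + of_int a, snd z + of_int b)"
    using assms(2) unfolding torus_proj_eq_iff by blast
  then show thesis using that[of b] by (simp add: TQ_funpow_shift[OF assms(1)])
qed

section \<open>From the heights along one lift to the rotation vector\<close>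

lemma rotation_vector_if_snd_bounded:
  assumes T: "T \<in> TQ" and x: "torus_proj z = x"
    and bd: "\<And>n. \<bar>snd ((T ^^ n) z) - snd z\<bar> < C"
    and lim: "(\<lambda>n. (fst ((T ^^ n) z) - fst z) / real n) \<longlonglongrightarrow> \<alpha>"
  shows "(\<exists>C>0. \<forall>n>0. \<forall>z. torus_proj z = x \<longrightarrow> \<bar>snd ((T ^^ n) z) - snd z\<bar> < C) \<and>
         (\<exists>\<omega>::real. 0 \<le> \<omega> \<and> \<omega> < 1 \<and> torus_has_rotation_vector T x (ereal \<omega>, 0))"
proof
  have "C > 0" using bd[of 0] by simp
  moreover have "\<bar>snd ((T ^^ n) w) - snd w\<bar> < C" if w: "torus_proj w = x" for n w
  proof -
    obtain b :: int where b: "\<And>n. snd ((T ^^ n) w) = snd ((T ^^ n) z) + of_int b"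
      using torus_proj_funpow_snd_diff[OF T] x w by metis
    \<comment> \<open>The integer offset is the same at time \<open>n\<close> and at time 0, so it
      cancels and \<open>C\<close> serves every lift.\<close>
    show ?thesis using b[of n] b[of 0] bd[of n] by simp
  qed
  ultimately show "\<exists>C>0. \<forall>n>0. \<forall>z. torus_proj z = x \<longrightarrow> \<bar>snd ((T ^^ n) z) - snd z\<bar> < C"
    by blast
next
  have "(\<lambda>n. (snd ((T ^^ n) z) - snd z) / real n) \<longlonglongrightarrow> 0"
    by (rule bounded_div_tendsto_0) (rule less_imp_le[OF bd])
  then have "(\<lambda>n. ereal ((snd ((T ^^ n) z) - snd z) / real n)) \<longlonglongrightarrow> 0"
    by (simp add: zero_ereal_def)
  then have "has_rotation_vector T z (ereal \<alpha>, 0)"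
    unfolding has_rotation_vector_def using lim by (intro tendsto_Pair) simp_all
  then have "torus_has_rotation_vector T x (ereal (frac \<alpha>), 0)"
    unfolding torus_has_rotation_vector_def using x by (intro exI conjI) auto
  then show "\<exists>\<omega>::real. 0 \<le> \<omega> \<and> \<omega> < 1 \<and> torus_has_rotation_vector T x (ereal \<omega>, 0)"
    using frac_ge_0 frac_lt_1 by blast
qed

text \<open>The sign of \<open>\<omega>\<close> decides the direction: the heights follow it, and
  the horizontal displacement, which accumulates the heights up to a bounded error per step, has
  infinite speed of the same sign.\<close>

lemma rotation_vector_if_snd_drifts:
  assumes T: "T \<in> TQ" and x: "torus_proj z = x" and "\<omega> \<noteq> 0"
    and lim: "(\<lambda>n. (snd ((T ^^ n) z) - snd z) / real n) \<longlonglongrightarrow> \<omega>"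
  shows "((\<forall>z. torus_proj z = x \<longrightarrow> filterlim (\<lambda>n. snd ((T ^^ n) z)) at_top sequentially) \<and>
          torus_has_rotation_vector T x (\<infinity>, ereal \<omega>)) \<or>
         ((\<forall>z. torus_proj z = x \<longrightarrow> filterlim (\<lambda>n. snd ((T ^^ n) z)) at_bot sequentially) \<and>
          torus_has_rotation_vector T x (-\<infinity>, ereal \<omega>))"
proof -
  define s where "s n = snd ((T ^^ n) z)" for n
  define u where "u n = fst ((T ^^ n) z) - fst z" for n
  obtain C where C: "\<And>z. \<bar>fst (T z) - fst z - snd z\<bar> \<le> C"
    using TQ_horizontal_step[OF T] by blast
  have step: "s n - C \<le> u (Suc n) - u n" "u (Suc n) - u n \<le> s n + C" for n
    using C[of "(T ^^ n) z"] by (simp_all add: s_def u_def)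
  have lims: "(\<lambda>n. (s n - snd z) / real n) \<longlonglongrightarrow> \<omega>"
    using lim by (simp add: s_def)
  then have lim': "(\<lambda>n. ereal ((snd ((T ^^ n) z) - snd z) / real n)) \<longlonglongrightarrow> ereal \<omega>"
    by (simp add: s_def)
  show ?thesis
  proof (cases "\<omega> > 0")
    case True
    then have s: "filterlim s at_top sequentially"
      using filterlim_at_top_of_div_tendsto_pos[OF lims] by blast
    have "filterlim (\<lambda>n. - C + s n) at_top sequentially"
      by (rule filterlim_tendsto_add_at_top[OF tendsto_const s])
    then have "filterlim (\<lambda>n. u (Suc n) - u n) at_top sequentially"
      by (rule filterlim_at_top_mono) (use step(1) in \<open>simp add: always_eventually\<close>)
    then have "(\<lambda>n. ereal (u n / real n)) \<longlonglongrightarrow> \<infinity>"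
      unfolding tendsto_PInfty_eq_at_top by (rule filterlim_at_top_div_of_increments)
    then have "has_rotation_vector T z (\<infinity>, ereal \<omega>)"
      unfolding has_rotation_vector_def u_def using lim' by (intro tendsto_Pair)
    then have "torus_has_rotation_vector T x (\<infinity>, ereal \<omega>)"
      unfolding torus_has_rotation_vector_def using x by (intro exI conjI) auto
    moreover have "filterlim (\<lambda>n. snd ((T ^^ n) w)) at_top sequentially"
      if w: "torus_proj w = x" for w
    proof -
      obtain b :: int where "\<And>n. snd ((T ^^ n) w) = s n + of_int b"
        using torus_proj_funpow_snd_diff[OF T] x w unfolding s_def by metis
      then show ?thesis
        using filterlim_tendsto_add_at_top[OF tendsto_const[of "of_int b"] s]
        by (simp add: add.commute)
    qed
    ultimately show ?thesis by blast
  next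
    \<comment> \<open>The downward case is the upward one applied to \<open>- s\<close> and
      \<open>- u\<close>; the upper half of \<open>step\<close> now plays the part of the lower
      half.\<close>
    case False
    with \<open>\<omega> \<noteq> 0\<close> have "- \<omega> > 0" by simp
    moreover have "(\<lambda>n. (- s n - - snd z) / real n) \<longlonglongrightarrow> - \<omega>"
      using tendsto_minus[OF lims] by (simp add: minus_divide_left)
    ultimately have s: "filterlim (\<lambda>n. - s n) at_top sequentially"
      by (intro filterlim_at_top_of_div_tendsto_pos)
    have "filterlim (\<lambda>n. - C + - s n) at_top sequentially"
      by (rule filterlim_tendsto_add_at_top[OF tendsto_const s])
    then have "filterlim (\<lambda>n. - u (Suc n) - - u n) at_top sequentially"
      by (rule filterlim_at_top_mono) (use step(2) in \<open>simp add: always_eventually algebra_simps\<close>)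
    then have "filterlim (\<lambda>n. - u n / real n) at_top sequentially"
      by (rule filterlim_at_top_div_of_increments)
    then have "(\<lambda>n. ereal (u n / real n)) \<longlonglongrightarrow> -\<infinity>"
      by (subst ereal_Lim_uminus) (simp add: tendsto_PInfty_eq_at_top)
    then have "has_rotation_vector T z (-\<infinity>, ereal \<omega>)"
      unfolding has_rotation_vector_def u_def using lim' by (intro tendsto_Pair)
    then have "torus_has_rotation_vector T x (-\<infinity>, ereal \<omega>)"
      unfolding torus_has_rotation_vector_def using x by (intro exI conjI) auto
    moreover have "filterlim (\<lambda>n. snd ((T ^^ n) w)) at_bot sequentially"
      if w: "torus_proj w = x" for w
    proof -
      obtain b :: int where "\<And>n. snd ((T ^^ n) w) = s n + of_int b"
        using torus_proj_funpow_snd_diff[OF T] x w unfolding s_def by metis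
      then show ?thesis
        using filterlim_tendsto_add_at_top[OF tendsto_const[of "- of_int b"] s]
        by (simp add: filterlim_uminus_at_bot add.commute)
    qed
    ultimately show ?thesis by blast
  qed
qed

section \<open>Lifts of periodic orbits and of Aubry--Mather sets\<close>

lemma torus_map_funpow_proj:
  assumes "T \<in> TQ"
  shows "(torus_map T ^^ n) (torus_proj z) = torus_proj ((T ^^ n) z)"
  by (induction n) (simp_all add: torus_map_proj[OF assms])

lemma cyl_map_funpow_proj:
  assumes "T \<in> TQ"
  shows "(cyl_map T ^^ n) (cyl_proj z) = cyl_proj ((T ^^ n) z)"
  by (induction n) (simp_all add: cyl_map_proj[OF assms])

text \<open>Iterates of \<open>f\<close> commute, so a period of the base point is a period of every
  point of its orbit.\<close>

lemma periodic_orbit_funpow_eq: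
  assumes "periodic_orbit f A" and "x \<in> A"
  obtains n where "n \<ge> 1" and "(f ^^ n) x = x"
proof -
  obtain y n k where n: "n \<ge> 1" "(f ^^ n) y = y" and "x = (f ^^ k) y"
    using assms unfolding periodic_orbit_def by blast
  then have "(f ^^ n) x = x" by (metis add.commute comp_apply funpow_add)
  with n that show thesis by blast
qed

text \<open>A closed orbit on the torus makes \<open>(T ^^ n) z\<close> an integer translate of
  \<open>z\<close>, to which \<open>T ^^ m\<close> is applied. The term \<open>m * b\<close> is the
  effect of the twist: each application of \<open>T\<close> turns a vertical shift by
  \<open>b\<close> into a further horizontal shift by \<open>b\<close>.\<close>

lemma periodic_lift:
  assumes T: "T \<in> TQ" and "(torus_map T ^^ n) (torus_proj z) = torus_proj z"
  obtains a b :: int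
  where "\<And>m. fst ((T ^^ (m + n)) z) = fst ((T ^^ m) z) + of_int a + real m * of_int b"
    and "\<And>m. snd ((T ^^ (m + n)) z) = snd ((T ^^ m) z) + of_int b"
proof -
  have "torus_proj z = torus_proj ((T ^^ n) z)"
    using assms by (simp add: torus_map_funpow_proj)
  then obtain a b :: int where "(T ^^ n) z = (fst z + of_int a, snd z + of_int b)"
    unfolding torus_proj_eq_iff by blast
  then have "(T ^^ (m + n)) z =
      (fst ((T ^^ m) z) + of_int a + real m * of_int b, snd ((T ^^ m) z) + of_int b)" for m
    by (simp add: funpow_add TQ_funpow_shift[OF T])
  then show thesis using that[of a b] by simp
qed

text \<open>The orbit stays in a compact subset of the cylinder, and \<open>cyl_proj\<close> keeps
  the second coordinate, so heights in the plane are heights in that set.\<close>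

lemma Aubry_Mather_snd_bounded:
  assumes T: "T \<in> TQ" and Q: "Aubry_Mather_set T Q" and z: "cyl_proj z \<in> Q"
  shows "\<exists>C. \<forall>n. \<bar>snd ((T ^^ n) z) - snd z\<bar> < C"
proof -
  have "compact Q" and inv: "cyl_map T ` Q = Q"
    using Q by (simp_all add: Aubry_Mather_set_def)
  then have "compact (snd ` Q)" by (intro compact_continuous_image continuous_intros)
  then have "bounded (snd ` Q)" by (rule compact_imp_bounded)
  then obtain B where B: "\<And>w. w \<in> Q \<Longrightarrow> \<bar>snd w\<bar> \<le> B"
    unfolding bounded_iff by auto
  have "(cyl_map T ^^ n) (cyl_proj z) \<in> Q" for n
    using z inv by (induction n) auto
  then have le: "\<bar>snd ((T ^^ n) z)\<bar> \<le> B" for n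
    using B[of "cyl_proj ((T ^^ n) z)"] cyl_map_funpow_proj[OF T, of n z]
    by (metis cyl_proj_def id_apply snd_map_prod)
  \<comment> \<open>\<open>2 * B\<close> is the triangle inequality; the added 1 makes the bound
    strict.\<close>
  have "\<bar>snd ((T ^^ n) z) - snd z\<bar> < 2 * B + 1" for n
    using le[of n] le[of 0] unfolding funpow_0 by linarith
  then show ?thesis by blast
qed

theorem theorem1:
  fixes T :: "plane \<Rightarrow> plane" and x :: torus
  assumes "T \<in> TQ"
    and "(\<exists>A. periodic_orbit (torus_map T) A \<and> x \<in> A) \<or>
         (\<exists>Q. quasi_periodic_set T Q \<and> x \<in> Q)"
  shows "((\<exists>C>0. \<forall>n>0. \<forall>z. torus_proj z = x \<longrightarrow> \<bar>snd ((T ^^ n) z) - snd z\<bar> < C) \<and>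
          (\<exists>\<omega>::real. 0 \<le> \<omega> \<and> \<omega> < 1 \<and> torus_has_rotation_vector T x (ereal \<omega>, 0))) \<or>
         ((\<forall>z. torus_proj z = x \<longrightarrow> filterlim (\<lambda>n. snd ((T ^^ n) z)) at_top sequentially) \<and>
          (\<exists>\<omega>::real. \<omega> \<noteq> 0 \<and> torus_has_rotation_vector T x (\<infinity>, ereal \<omega>))) \<or>
         ((\<forall>z. torus_proj z = x \<longrightarrow> filterlim (\<lambda>n. snd ((T ^^ n) z)) at_bot sequentially) \<and>
          (\<exists>\<omega>::real. \<omega> \<noteq> 0 \<and> torus_has_rotation_vector T x (-\<infinity>, ereal \<omega>)))"
proof -
  note T = assms(1)
  consider (per) A where "periodic_orbit (torus_map T) A" "x \<in> A"
    | (AM) Q where "Aubry_Mather_set T Q" "x \<in> cyl_to_torus ` Q"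
    | (irr) \<omega> v where "\<omega> \<notin> \<rat>" "torus_has_rotation_vector T x v" "snd v = ereal \<omega>"
    using assms(2) unfolding quasi_periodic_set_def by metis
  then show ?thesis
  proof cases
    case per
    obtain z where x: "torus_proj z = x" by (metis surj_torus_proj surjE)
    obtain n where n: "n \<ge> 1" "(torus_map T ^^ n) x = x"
      using periodic_orbit_funpow_eq[OF per] .
    then obtain a b :: int
      where a: "\<And>m. fst ((T ^^ (m + n)) z) = fst ((T ^^ m) z) + of_int a + real m * of_int b"
        and b: "\<And>m. snd ((T ^^ (m + n)) z) = snd ((T ^^ m) z) + of_int b"
      using periodic_lift[OF T, of n z] x by auto
    show ?thesis
    \<comment> \<open>\<open>b\<close> counts the vertical turns around the torus per period. If it
      is 0, the heights are periodic and the horizontal gain per period is the constant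
      \<open>a\<close>, the term \<open>m * b\<close> being gone; otherwise the vertical speed is
      \<open>b / n\<close>.\<close>
    proof (cases "b = 0")
      case True
      then obtain C where "\<And>m. \<bar>snd ((T ^^ m) z) - snd z\<bar> < C"
        using bounded_if_periodic[OF n(1), of "\<lambda>m. snd ((T ^^ m) z) - snd z"] b by auto
      moreover have "(\<lambda>m. (fst ((T ^^ m) z) - fst z) / real m) \<longlonglongrightarrow> of_int a / real n"
        using div_tendsto_of_periodic_increments[OF n(1), of "\<lambda>m. fst ((T ^^ m) z)" "of_int a"] a True
        by simp
      ultimately show ?thesis using rotation_vector_if_snd_bounded[OF T x] by blast
    next
      case False
      moreover have "(\<lambda>m. (snd ((T ^^ m) z) - snd z) / real m) \<longlonglongrightarrow> of_int b / real n"
        using div_tendsto_of_periodic_increments[OF n(1), of "\<lambda>m. snd ((T ^^ m) z)", OF b] by simp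
      moreover have "of_int b / real n \<noteq> 0" using False n(1) by simp
      ultimately show ?thesis using rotation_vector_if_snd_drifts[OF T x] by blast
    qed
  next
    case AM
    \<comment> \<open>The lift is chosen over a point of \<open>Q\<close>, since an arbitrary lift
      of \<open>x\<close> may project to a vertical translate outside \<open>Q\<close>.\<close>
    then obtain z where z: "cyl_proj z \<in> Q" and x: "x = cyl_to_torus (cyl_proj z)"
      by (metis imageE surj_cyl_proj surjE)
    then have "torus_proj z = x"
      by (cases z) (simp add: torus_proj_def cyl_proj_def cyl_to_torus_def)
    moreover obtain \<alpha> where "has_rotation_number T Q \<alpha>"
      using AM(1) unfolding Aubry_Mather_set_def by blast
    ultimately show ?thesis
      using rotation_vector_if_snd_bounded[OF T] Aubry_Mather_snd_bounded[OF T AM(1) z] z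
      unfolding has_rotation_number_def by blast
  next
    case irr
    then have "\<omega> \<noteq> 0" by auto
    \<comment> \<open>As \<open>snd v\<close> is nonzero, the alternative with second coordinate 0
      is excluded, so \<open>v\<close> is the rotation vector of the lift itself.\<close>
    then obtain z where x: "torus_proj z = x" and "has_rotation_vector T z v"
      using irr(2,3) unfolding torus_has_rotation_vector_def by (auto simp: zero_ereal_def)
    then have "(\<lambda>n. (snd ((T ^^ n) z) - snd z) / real n) \<longlonglongrightarrow> \<omega>"
      using tendsto_snd irr(3) unfolding has_rotation_vector_def by fastforce
    then show ?thesis using rotation_vector_if_snd_drifts[OF T x \<open>\<omega> \<noteq> 0\<close>] \<open>\<omega> \<noteq> 0\<close> by blast
  qed
qed

end
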